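(* Let $b_n$ be the number of permutations of $[n]$ all of whose peaks and valleys are even, and let $c_n$ be the number of permutations of $[n]$ all of whose peaks and valleys are odd ($b_0=c_0=1$). Then $$\sum_{n\ge0}b_n\frac{x^n}{n!}=(1+x)\frac{2+2\cosh(\sqrt2 x)+\sqrt2 x\sinh(\sqrt2 x)}{2+2\cosh(\sqrt2 x)-\sqrt2 x\sinh(\sqrt2 x)}$$ and $$\sum_{n\ge0}c_n\frac{x^n}{n!}=\frac{2+2\cosh(\sqrt2 x)+\sqrt2(2+x)\sinh(\sqrt2 x)}{2+2\cosh(\sqrt2 x)-\sqrt2 x\sinh(\sqrt2 x)}.$$
   Context: For a permutation $\pi=\pi_1\cdots\pi_n$, an index $i$ (with $2\le i\le n-1$) is a peak if $\pi_{i-1}<\pi_i>\pi_{i+1}$ and a valley if $\pi_{i-1}>\pi_i<\pi_{i+1}$. The conditions are vacuous for permutations with no peaks or valleys. *)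

theory Defs
  imports
    "HOL-Combinatorics.Permutations"
    "HOL-Computational_Algebra.Formal_Power_Series"
begin

text \<open>
  A permutation of \<open>{1..n}\<close> is a function \<open>\<pi>\<close> with \<open>\<pi> permutes {1..n}\<close>; its
  one-line word is \<open>\<pi> 1 \<dots> \<pi> n\<close>. Peaks and valleys are positions (indices), not values.
\<close>

definition is_peak :: "nat \<Rightarrow> (nat \<Rightarrow> nat) \<Rightarrow> nat \<Rightarrow> bool" where
  "is_peak n \<pi> i \<longleftrightarrow> 2 \<le> i \<and> i \<le> n - 1 \<and> \<pi> (i - 1) < \<pi> i \<and> \<pi> i > \<pi> (i + 1)"

definition is_valley :: "nat \<Rightarrow> (nat \<Rightarrow> nat) \<Rightarrow> nat \<Rightarrow> bool" where
  "is_valley n \<pi> i \<longleftrightarrow> 2 \<le> i \<and> i \<le> n - 1 \<and> \<pi> (i - 1) > \<pi> i \<and> \<pi> i < \<pi> (i + 1)"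

definition num_even_peaks_valleys :: "nat \<Rightarrow> nat" where
  "num_even_peaks_valleys n =
     card {\<pi>. \<pi> permutes {1..n} \<and> (\<forall>i. is_peak n \<pi> i \<or> is_valley n \<pi> i \<longrightarrow> even i)}"

definition num_odd_peaks_valleys :: "nat \<Rightarrow> nat" where
  "num_odd_peaks_valleys n =
     card {\<pi>. \<pi> permutes {1..n} \<and> (\<forall>i. is_peak n \<pi> i \<or> is_valley n \<pi> i \<longrightarrow> odd i)}"

text \<open>The formal power series of \<open>cosh (c x)\<close> and \<open>sinh (c x)\<close>.\<close>

definition fps_cosh :: "'a::field_char_0 \<Rightarrow> 'a fps" where
  "fps_cosh c = fps_const (1 / 2) * (fps_exp c + fps_exp (- c))"

definition fps_sinh :: "'a::field_char_0 \<Rightarrow> 'a fps" where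
  "fps_sinh c = fps_const (1 / 2) * (fps_exp c - fps_exp (- c))"

end

theory Submission
  imports Defs
begin

text \<open>
  If all peaks and valleys are odd, the letters in positions \<open>2 k + 1\<close>, \<open>2 k + 2\<close>, \<open>2 k + 3\<close> are
  monotone, so the number \<open>a\<^bsub>k\<^esub>(x)\<close> of such permutations of length \<open>2 k + 1\<close> with last letter
  \<open>x + 1\<close> satisfies \<open>a\<^bsub>k+1\<^esub>(x) = (\<Sum>y. \<bar>x - 1 - y\<bar> * a\<^bsub>k\<^esub>(y))\<close>. The second difference of this
  kernel is twice the identity, which explains the \<open>sqrt 2\<close> in the formulas. The initial value and
  slope of \<open>a\<^bsub>k+1\<^esub>\<close> are multiples of \<open>\<Sum>y. a\<^bsub>k\<^esub>(y)\<close> (for the value, by the symmetry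
  \<open>x \<mapsto> 2 k - x\<close>), so summing Newton's forward difference expansion gives a convolution recurrence
  for the counts of odd length, that is, a linear equation for their generating function \<open>F\<close>.
  When the last letter but one may be a peak or valley, the last letter is unconstrained and a
  factor \<open>n\<close> splits off. Together with reversal in even length, this yields the series
  \<open>1 + F + x F\<close> for the odd case and \<open>(1 + x) (1 + x F)\<close> for the even case.
\<close>

section \<open>Appending a last letter\<close>

definition turning_perms :: "(nat \<Rightarrow> bool) \<Rightarrow> nat \<Rightarrow> (nat \<Rightarrow> nat) set" where
  "turning_perms P n =
     {\<pi>. \<pi> permutes {1..n} \<and> (\<forall>i. is_peak n \<pi> i \<or> is_valley n \<pi> i \<longrightarrow> P i)}"

text \<open>Old letters from \<open>j\<close> on are raised by one, so their relative order
  survives. Being the identity beyond \<open>Suc n\<close> makes the result a permutation in the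
  sense of \<open>permutes\<close>.\<close>

definition append_value :: "nat \<Rightarrow> nat \<Rightarrow> (nat \<Rightarrow> nat) \<Rightarrow> nat \<Rightarrow> nat" where
  "append_value n j \<sigma> =
     (\<lambda>i. if i = Suc n then j else if i \<in> {1..n} then if \<sigma> i < j then \<sigma> i else Suc (\<sigma> i) else i)"

lemma finite_turning_perms [simp]: "finite (turning_perms P n)"
  by (rule finite_subset[OF _ finite_permutations[of "{1..n}"]]) (auto simp: turning_perms_def)

lemma append_value_last [simp]: "append_value n j \<sigma> (Suc n) = j"
  by (simp add: append_value_def)

lemma append_value_less_iff:
  "i \<in> {1..n} \<Longrightarrow> i' \<in> {1..n} \<Longrightarrow>
     append_value n j \<sigma> i < append_value n j \<sigma> i' \<longleftrightarrow> \<sigma> i < \<sigma> i'"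
  by (auto simp: append_value_def)

lemma append_value_less_last_iff: "n \<ge> 1 \<Longrightarrow> append_value n j \<sigma> n < j \<longleftrightarrow> \<sigma> n < j"
  by (auto simp: append_value_def)

text \<open>The comparison becomes weak because an old letter equal to \<open>j\<close> is raised to
  \<open>Suc j\<close>.\<close>

lemma append_value_greater_last_iff: "n \<ge> 1 \<Longrightarrow> j < append_value n j \<sigma> n \<longleftrightarrow> j \<le> \<sigma> n"
  by (auto simp: append_value_def)

section \<open>Appending a letter as a bijection\<close>

lemma append_value_permutes:
  assumes "\<sigma> permutes {1..n}" "j \<in> {1..Suc n}"
  shows "append_value n j \<sigma> permutes {1..Suc n}"
proof (rule bij_imp_permutes)
  have inj: "inj_on (append_value n j \<sigma>) {1..Suc n}"
  proof (rule inj_onI)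
    fix x y assume xy: "x \<in> {1..Suc n}" "y \<in> {1..Suc n}"
      and eq: "append_value n j \<sigma> x = append_value n j \<sigma> y"
    have "\<sigma> x = \<sigma> y \<longleftrightarrow> x = y"
      using permutes_inj[OF assms(1)] by (auto dest: injD)
    with xy eq show "x = y"
      by (auto simp: append_value_def split: if_splits)
  qed
  have "append_value n j \<sigma> ` {1..Suc n} \<subseteq> {1..Suc n}"
  proof safe
    fix x assume x: "x \<in> {1..Suc n}"
    have "x \<noteq> Suc n \<Longrightarrow> \<sigma> x \<in> {1..n}"
      using x permutes_in_image[OF assms(1), of x] by auto
    with x assms(2) show "append_value n j \<sigma> x \<in> {1..Suc n}"
      by (auto simp: append_value_def)
  qed
  with inj show "bij_betw (append_value n j \<sigma>) {1..Suc n} {1..Suc n}"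
    by (simp add: bij_betw_def endo_inj_surj)
qed (auto simp: append_value_def)

lemma append_value_inj:
  assumes "\<sigma> permutes {1..n}" "\<tau> permutes {1..n}" "append_value n j \<sigma> = append_value n k \<tau>"
  shows "j = k \<and> \<sigma> = \<tau>"
proof
  show jk: "j = k"
    using fun_cong[OF assms(3), of "Suc n"] by simp
  show "\<sigma> = \<tau>"
  proof
    fix i
    show "\<sigma> i = \<tau> i"
    proof (cases "i \<in> {1..n}")
      case True
      with fun_cong[OF assms(3), of i] jk show ?thesis
        by (auto simp: append_value_def split: if_splits)
    next
      case False
      then show ?thesis
        using assms(1,2) by (simp add: permutes_not_in)
    qed
  qed
qed

text \<open>Injectivity suffices: both sets are finite with \<open>fact (Suc n)\<close> elements, so
  the image is everything.\<close>

lemma bij_betw_append_value: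
  "bij_betw (\<lambda>(j, \<sigma>). append_value n j \<sigma>)
     ({1..Suc n} \<times> {\<sigma>. \<sigma> permutes {1..n}}) {\<pi>. \<pi> permutes {1..Suc n}}"
proof -
  let ?f = "\<lambda>(j, \<sigma>). append_value n j \<sigma>"
  let ?A = "{1..Suc n} \<times> {\<sigma>. \<sigma> permutes {1..n}}"
  have inj: "inj_on ?f ?A"
  proof (rule inj_onI, clarify)
    fix j \<sigma> k \<tau>
    assume "\<sigma> permutes {1..n}" "\<tau> permutes {1..n}" "append_value n j \<sigma> = append_value n k \<tau>"
    then show "j = k \<and> \<sigma> = \<tau>"
      by (rule append_value_inj)
  qed
  have "card (?f ` ?A) = card ?A"
    by (rule card_image[OF inj])
  also have "\<dots> = card {\<pi>. \<pi> permutes {1..Suc n}}"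
    using card_permutations[of "{1..n}" n] card_permutations[of "{1..Suc n}" "Suc n"]
    by (simp add: card_cartesian_product)
  finally have "?f ` ?A = {\<pi>. \<pi> permutes {1..Suc n}}"
  proof (intro card_subset_eq finite_permutations finite_atLeastAtMost)
    show "?f ` ?A \<subseteq> {\<pi>. \<pi> permutes {1..Suc n}}"
    proof clarify
      fix j \<sigma> assume "j \<in> {1..Suc n}" "\<sigma> permutes {1..n}"
      then show "append_value n j \<sigma> permutes {1..Suc n}"
        by (intro append_value_permutes)
    qed
  qed
  with inj show ?thesis
    by (simp add: bij_betw_def)
qed

lemma append_value_cases:
  assumes "\<pi> permutes {1..Suc n}"
  obtains j \<sigma> where "j \<in> {1..Suc n}" "\<sigma> permutes {1..n}" "\<pi> = append_value n j \<sigma>"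
proof -
  have "\<pi> \<in> (\<lambda>(j, \<sigma>). append_value n j \<sigma>) ` ({1..Suc n} \<times> {\<sigma>. \<sigma> permutes {1..n}})"
    unfolding bij_betw_imp_surj_on[OF bij_betw_append_value] using assms by simp
  with that show thesis by auto
qed

text \<open>The only new position that may be a peak or valley is \<open>n\<close>.\<close>

lemma append_value_turning:
  assumes "\<sigma> permutes {1..n}" "j \<in> {1..Suc n}"
  shows "append_value n j \<sigma> \<in> turning_perms P (Suc n) \<longleftrightarrow>
     \<sigma> \<in> turning_perms P n \<and>
     (P n \<or> n < 2 \<or> (\<sigma> (n - 1) < \<sigma> n \<and> \<sigma> n < j) \<or> (\<sigma> (n - 1) > \<sigma> n \<and> j \<le> \<sigma> n))"
proof -
  let ?\<pi> = "append_value n j \<sigma>"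
  have inner: "(is_peak (Suc n) ?\<pi> i \<longleftrightarrow> is_peak n \<sigma> i) \<and>
      (is_valley (Suc n) ?\<pi> i \<longleftrightarrow> is_valley n \<sigma> i)" if "i \<noteq> n" for i
  proof (cases "2 \<le> i \<and> i + 1 \<le> n")
    case True
    then have "i - 1 \<in> {1..n}" "i \<in> {1..n}" "i + 1 \<in> {1..n}"
      by auto
    with True show ?thesis
      by (auto simp: is_peak_def is_valley_def append_value_less_iff)
  next
    case False
    with that show ?thesis
      by (auto simp: is_peak_def is_valley_def)
  qed
  \<comment> \<open>Position \<open>n\<close> is the last one of \<open>\<sigma>\<close>, so
    membership of \<open>\<sigma>\<close> imposes nothing there and the condition at
    \<open>n\<close> can be split off.\<close>
  have outer: "\<not> is_peak n \<sigma> n" "\<not> is_valley n \<sigma> n"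
    by (auto simp: is_peak_def is_valley_def)
  have ne: "\<sigma> (n - 1) \<noteq> \<sigma> n" if "n \<ge> 2"
    using permutes_inj[OF assms(1)] that by (auto dest!: injD)
  have last: "is_peak (Suc n) ?\<pi> n \<longleftrightarrow> 2 \<le> n \<and> \<sigma> (n - 1) < \<sigma> n \<and> j \<le> \<sigma> n"
             "is_valley (Suc n) ?\<pi> n \<longleftrightarrow> 2 \<le> n \<and> \<sigma> (n - 1) > \<sigma> n \<and> \<sigma> n < j"
    using append_value_less_iff[of "n - 1" n n j \<sigma>] append_value_less_iff[of n n "n - 1" j \<sigma>]
      append_value_less_last_iff[of n j \<sigma>] append_value_greater_last_iff[of n j \<sigma>]
    by (auto simp: is_peak_def is_valley_def)
  have "(\<forall>i. is_peak (Suc n) ?\<pi> i \<or> is_valley (Suc n) ?\<pi> i \<longrightarrow> P i) \<longleftrightarrow>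
        (\<forall>i. is_peak n \<sigma> i \<or> is_valley n \<sigma> i \<longrightarrow> P i) \<and>
        (is_peak (Suc n) ?\<pi> n \<or> is_valley (Suc n) ?\<pi> n \<longrightarrow> P n)"
    using inner outer by metis
  then show ?thesis
    using assms append_value_permutes[OF assms] ne
    by (auto simp: turning_perms_def last)
qed

text \<open>Here position \<open>n\<close> is either allowed to turn or has no left neighbour to
  turn against, so each of the \<open>Suc n\<close> last letters can be appended freely.\<close>

lemma card_turning_perms_Suc:
  assumes "P n \<or> n < 2"
  shows "card (turning_perms P (Suc n)) = Suc n * card (turning_perms P n)"
proof -
  let ?f = "\<lambda>(j, \<sigma>). append_value n j \<sigma>"
  have "bij_betw ?f ({1..Suc n} \<times> turning_perms P n) (turning_perms P (Suc n))"
  proof (rule bij_betw_subset[OF bij_betw_append_value])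
    show sub: "{1..Suc n} \<times> turning_perms P n \<subseteq> {1..Suc n} \<times> {\<sigma>. \<sigma> permutes {1..n}}"
      by (auto simp: turning_perms_def)
    show "?f ` ({1..Suc n} \<times> turning_perms P n) = turning_perms P (Suc n)"
    proof
      show "?f ` ({1..Suc n} \<times> turning_perms P n) \<subseteq> turning_perms P (Suc n)"
        using assms sub by (auto simp: append_value_turning subset_iff)
      show "turning_perms P (Suc n) \<subseteq> ?f ` ({1..Suc n} \<times> turning_perms P n)"
      proof
        fix \<pi> assume \<pi>: "\<pi> \<in> turning_perms P (Suc n)"
        then have "\<pi> permutes {1..Suc n}"
          by (simp add: turning_perms_def)
        then obtain j \<sigma> where "j \<in> {1..Suc n}" "\<sigma> permutes {1..n}" "\<pi> = append_value n j \<sigma>"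
          by (rule append_value_cases)
        with \<pi> show "\<pi> \<in> ?f ` ({1..Suc n} \<times> turning_perms P n)"
          by (auto simp: append_value_turning intro!: rev_image_eqI[of "(j, \<sigma>)"])
      qed
    qed
  qed
  then have "card (turning_perms P (Suc n)) = card ({1..Suc n} \<times> turning_perms P n)"
    by (simp add: bij_betw_same_card)
  then show ?thesis
    by (simp add: card_cartesian_product)
qed

text \<open>The middle letter \<open>j\<close> is free with respect to position \<open>n\<close>,
  whereas position \<open>Suc n\<close> must not turn, so the last three letters are monotone.
  Ascents give strict and descents weak inequalities because \<open>j\<close> and \<open>m\<close>
  are compared with letters not yet raised.\<close>

lemma append_two_values_turning:
  assumes "\<sigma> permutes {1..n}" "j \<in> {1..Suc n}" "m \<in> {1..Suc (Suc n)}"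
    and "n \<ge> 1" "P n \<or> n < 2" "\<not> P (Suc n)"
  shows "append_value (Suc n) m (append_value n j \<sigma>) \<in> turning_perms P (Suc (Suc n)) \<longleftrightarrow>
     \<sigma> \<in> turning_perms P n \<and> (\<sigma> n < j \<and> j < m \<or> m \<le> j \<and> j \<le> \<sigma> n)"
proof -
  have "append_value n j \<sigma> \<in> turning_perms P (Suc n) \<longleftrightarrow> \<sigma> \<in> turning_perms P n"
    using append_value_turning[OF assms(1,2), of P] assms(5) by argo
  moreover have "\<not> Suc n < 2"
    using assms(4) by simp
  ultimately show ?thesis
    unfolding append_value_turning[OF append_value_permutes[OF assms(1,2)] assms(3), of P]
    using assms(4,6)
    by (simp add: append_value_less_last_iff append_value_greater_last_iff) linarith
qed

text \<open>The weight counts the middle letters between a given \<open>\<sigma> n = Suc y\<close>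
  and the last letter \<open>Suc x\<close>. They form an interval without its endpoints when
  ascending and with both when descending; this asymmetry is the \<open>- 1\<close> in the
  kernel.\<close>

lemma card_turning_perms_last_Suc_Suc:
  assumes "n \<ge> 1" "P n \<or> n < 2" "\<not> P (Suc n)" "x \<le> Suc n"
  shows "real (card {\<pi> \<in> turning_perms P (Suc (Suc n)). \<pi> (Suc (Suc n)) = Suc x}) =
     (\<Sum>y<n. \<bar>real x - 1 - real y\<bar> * real (card {\<sigma> \<in> turning_perms P n. \<sigma> n = Suc y}))"
proof -
  define J where
    "J = (\<lambda>\<sigma>::nat \<Rightarrow> nat. {j. \<sigma> n < j \<and> j < Suc x \<or> Suc x \<le> j \<and> j \<le> \<sigma> n})"
  let ?f = "\<lambda>(\<sigma>, j). append_value (Suc n) (Suc x) (append_value n j \<sigma>)"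
  let ?T = "turning_perms P n"
  let ?R = "{\<pi> \<in> turning_perms P (Suc (Suc n)). \<pi> (Suc (Suc n)) = Suc x}"
  have perm: "\<sigma> permutes {1..n}" if "\<sigma> \<in> ?T" for \<sigma>
    using that by (simp add: turning_perms_def)
  have range: "\<sigma> n \<in> {1..n}" if "\<sigma> \<in> ?T" for \<sigma>
    using permutes_in_image[OF perm[OF that], of n] assms(1) by simp
  have J_sub: "J \<sigma> \<subseteq> {1..Suc n}" if "\<sigma> \<in> ?T" for \<sigma>
    using range[OF that] assms(4) by (auto simp: J_def)
  have bij: "bij_betw ?f (Sigma ?T J) ?R"
    unfolding bij_betw_def
  proof
    show "inj_on ?f (Sigma ?T J)"
    proof (rule inj_onI, clarify)
      fix \<sigma> j \<tau> k
      assume *: "\<sigma> \<in> ?T" "j \<in> J \<sigma>" "\<tau> \<in> ?T" "k \<in> J \<tau>"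
        and eq: "append_value (Suc n) (Suc x) (append_value n j \<sigma>) =
                 append_value (Suc n) (Suc x) (append_value n k \<tau>)"
      have "append_value n j \<sigma> = append_value n k \<tau>"
        using append_value_inj[OF append_value_permutes append_value_permutes eq]
          * perm J_sub by (auto simp: subset_iff)
      then show "\<sigma> = \<tau> \<and> j = k"
        using append_value_inj * perm by blast
    qed
    show "?f ` Sigma ?T J = ?R"
    proof
      show "?f ` Sigma ?T J \<subseteq> ?R"
      proof clarify
        fix \<sigma> j assume \<sigma>: "\<sigma> \<in> ?T" and j: "j \<in> J \<sigma>"
        then have "append_value (Suc n) (Suc x) (append_value n j \<sigma>) \<in> turning_perms P (Suc (Suc n))"
          using append_two_values_turning[OF perm[OF \<sigma>], of j "Suc x" P] J_sub[OF \<sigma>] assms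
          by (auto simp: J_def)
        then show "append_value (Suc n) (Suc x) (append_value n j \<sigma>) \<in> turning_perms P (Suc (Suc n)) \<and>
            append_value (Suc n) (Suc x) (append_value n j \<sigma>) (Suc (Suc n)) = Suc x"
          by simp
      qed
      show "?R \<subseteq> ?f ` Sigma ?T J"
      proof
        fix \<pi> assume \<pi>: "\<pi> \<in> ?R"
        then have "\<pi> permutes {1..Suc (Suc n)}"
          by (simp add: turning_perms_def)
        then obtain m \<tau> where m: "m \<in> {1..Suc (Suc n)}" and \<tau>: "\<tau> permutes {1..Suc n}"
          and \<pi>_eq: "\<pi> = append_value (Suc n) m \<tau>"
          by (rule append_value_cases)
        from \<tau> obtain j \<sigma> where j: "j \<in> {1..Suc n}" and \<sigma>: "\<sigma> permutes {1..n}"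
          and \<tau>_eq: "\<tau> = append_value n j \<sigma>"
          by (rule append_value_cases)
        have "m = Suc x"
          using \<pi> \<pi>_eq by simp
        then show "\<pi> \<in> ?f ` Sigma ?T J"
          using append_two_values_turning[OF \<sigma> j m assms(1-3)] \<pi>
          by (auto simp: \<pi>_eq \<tau>_eq J_def intro!: rev_image_eqI[of "(\<sigma>, j)"])
      qed
    qed
  qed
  have card_J: "real (card (J \<sigma>)) = \<bar>real x - 1 - real y\<bar>" if "\<sigma> n = Suc y" for \<sigma> y
  proof (cases "x \<le> y")
    case True
    then have "J \<sigma> = {Suc x..Suc y}"
      using that by (auto simp: J_def)
    with True show ?thesis by simp
  next
    case False
    then have "J \<sigma> = {Suc (Suc y)..<Suc x}"
      using that by (auto simp: J_def)
    with False show ?thesis by simp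
  qed
  have "real (card ?R) = (\<Sum>\<sigma>\<in>?T. real (card (J \<sigma>)))"
  proof -
    have "\<forall>\<sigma>\<in>?T. finite (J \<sigma>)"
      using J_sub finite_subset by blast
    then show ?thesis
      unfolding bij_betw_same_card[OF bij, symmetric] by (subst card_SigmaI) simp_all
  qed
  also have "\<dots> = (\<Sum>y<n. \<Sum>\<sigma>\<in>{\<sigma> \<in> ?T. \<sigma> n - 1 = y}. real (card (J \<sigma>)))"
    by (rule sum.group[symmetric]) (use range in fastforce)+
  also have "\<dots> = (\<Sum>y<n. \<bar>real x - 1 - real y\<bar> * real (card {\<sigma> \<in> ?T. \<sigma> n = Suc y}))"
  proof (rule sum.cong[OF refl])
    fix y
    have "{\<sigma> \<in> ?T. \<sigma> n - 1 = y} = {\<sigma> \<in> ?T. \<sigma> n = Suc y}"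
      using range by fastforce
    then show "(\<Sum>\<sigma>\<in>{\<sigma> \<in> ?T. \<sigma> n - 1 = y}. real (card (J \<sigma>))) =
        \<bar>real x - 1 - real y\<bar> * real (card {\<sigma> \<in> ?T. \<sigma> n = Suc y})"
      by (simp add: card_J)
  qed
  finally show ?thesis .
qed

text \<open>Reading a word backwards keeps peaks and valleys and moves position \<open>i\<close> to
  \<open>Suc n - i\<close>. For even \<open>n\<close> this exchanges odd and even positions.\<close>

lemma card_turning_perms_reverse:
  assumes "\<And>i. i \<in> {1..n} \<Longrightarrow> Q (Suc n - i) \<longleftrightarrow> P i"
  shows "card (turning_perms P n) = card (turning_perms Q n)"
proof -
  define r where "r = (\<lambda>i. if i \<in> {1..n} then Suc n - i else i)"
  have rr: "r (r i) = i" for i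
    by (auto simp: r_def)
  have r: "r permutes {1..n}"
    by (rule bij_imp_permutes) (auto simp: r_def intro!: bij_betwI[of _ _ _ r])
  have turn: "(is_peak n (\<pi> \<circ> r) i \<longleftrightarrow> is_peak n \<pi> (Suc n - i)) \<and>
      (is_valley n (\<pi> \<circ> r) i \<longleftrightarrow> is_valley n \<pi> (Suc n - i))" if "i \<in> {1..n}" for \<pi> i
  proof (cases "2 \<le> i \<and> i \<le> n - 1")
    case True
    then have "r (i - 1) = Suc n - i + 1" "r i = Suc n - i" "r (i + 1) = Suc n - i - 1"
      by (auto simp: r_def)
    moreover have "2 \<le> Suc n - i" "Suc n - i \<le> n - 1"
      using True by auto
    ultimately show ?thesis
      unfolding is_peak_def is_valley_def comp_apply using True by metis
  next
    case False
    moreover have "\<not> (2 \<le> Suc n - i \<and> Suc n - i \<le> n - 1)"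
      using False that by auto
    ultimately show ?thesis
      unfolding is_peak_def is_valley_def by metis
  qed
  have range: "i \<in> {1..n}" if "is_peak n \<pi> i \<or> is_valley n \<pi> i" for \<pi> i
    using that by (auto simp: is_peak_def is_valley_def)
  \<comment> \<open>General predicates \<open>A\<close> and \<open>B\<close> let one argument serve
    both directions of the bijection, since reversal is its own inverse.\<close>
  have maps: "\<pi> \<circ> r \<in> turning_perms B n"
    if "\<pi> \<in> turning_perms A n" "\<And>i. i \<in> {1..n} \<Longrightarrow> A (Suc n - i) \<longleftrightarrow> B i" for \<pi> A B
    unfolding turning_perms_def
  proof (intro CollectI conjI allI impI)
    show "\<pi> \<circ> r permutes {1..n}"
      using that(1) by (intro permutes_compose[OF r]) (simp add: turning_perms_def)
    fix i assume i: "is_peak n (\<pi> \<circ> r) i \<or> is_valley n (\<pi> \<circ> r) i"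
    with range have n: "i \<in> {1..n}" by blast
    with i turn have "is_peak n \<pi> (Suc n - i) \<or> is_valley n \<pi> (Suc n - i)"
      by simp
    with that(1) have "A (Suc n - i)"
      unfolding turning_perms_def by blast
    with that(2) n show "B i"
      by simp
  qed
  have "bij_betw (\<lambda>\<pi>. \<pi> \<circ> r) (turning_perms P n) (turning_perms Q n)"
  proof (rule bij_betwI[where g = "\<lambda>\<pi>. \<pi> \<circ> r"])
    have "P (Suc n - i) \<longleftrightarrow> Q i" if "i \<in> {1..n}" for i
    proof -
      have "Suc n - i \<in> {1..n}" "Suc n - (Suc n - i) = i"
        using that by auto
      with assms[of "Suc n - i"] show ?thesis by simp
    qed
    then show "(\<lambda>\<pi>. \<pi> \<circ> r) \<in> turning_perms P n \<rightarrow> turning_perms Q n"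
      by (intro funcsetI) (rule maps)
    show "(\<lambda>\<pi>. \<pi> \<circ> r) \<in> turning_perms Q n \<rightarrow> turning_perms P n"
      using assms by (intro funcsetI) (rule maps)
  qed (auto simp: rr fun_eq_iff)
  then show ?thesis
    by (rule bij_betw_same_card)
qed

section \<open>Counting by the last letter\<close>

primrec end_count :: "nat \<Rightarrow> nat \<Rightarrow> real" where
  "end_count 0 x = (if x = 0 then 1 else 0)"
| "end_count (Suc k) x = (\<Sum>y\<le>2 * k. \<bar>real x - 1 - real y\<bar> * end_count k y)"

lemma card_odd_turning_perms_last:
  "x \<le> 2 * k \<Longrightarrow>
     real (card {\<pi> \<in> turning_perms odd (2 * k + 1). \<pi> (2 * k + 1) = Suc x}) = end_count k x"
proof (induction k arbitrary: x)
  case 0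
  have "{\<pi> \<in> turning_perms odd 1. \<pi> 1 = Suc 0} = {id}"
    by (auto simp: turning_perms_def is_peak_def is_valley_def)
  with 0 show ?case by simp
next
  case (Suc k)
  have "real (card {\<pi> \<in> turning_perms odd (2 * Suc k + 1). \<pi> (2 * Suc k + 1) = Suc x}) =
      (\<Sum>y<2 * k + 1. \<bar>real x - 1 - real y\<bar> *
         real (card {\<sigma> \<in> turning_perms odd (2 * k + 1). \<sigma> (2 * k + 1) = Suc y}))"
    using card_turning_perms_last_Suc_Suc[of "2 * k + 1" odd x] Suc.prems by simp
  also have "\<dots> = end_count (Suc k) x"
    using Suc.IH by (simp add: lessThan_Suc_atMost)
  finally show ?case .
qed

lemma card_odd_turning_perms_odd:
  "real (card (turning_perms odd (2 * k + 1))) = (\<Sum>x\<le>2 * k. end_count k x)"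
proof -
  let ?T = "turning_perms odd (2 * k + 1)"
  have range: "\<pi> (2 * k + 1) \<in> {1..2 * k + 1}" if "\<pi> \<in> ?T" for \<pi>
    using permutes_in_image[of \<pi> "{1..2 * k + 1}" "2 * k + 1"] that by (simp add: turning_perms_def)
  have "real (card ?T) = (\<Sum>\<pi>\<in>?T. 1)"
    by simp
  also have "\<dots> = (\<Sum>x\<le>2 * k. \<Sum>\<pi>\<in>{\<pi> \<in> ?T. \<pi> (2 * k + 1) - 1 = x}. 1)"
    by (rule sum.group[symmetric]) (use range in fastforce)+
  also have "\<dots> = (\<Sum>x\<le>2 * k. end_count k x)"
  proof (rule sum.cong[OF refl])
    fix x assume "x \<in> {..2 * k}"
    moreover have "{\<pi> \<in> ?T. \<pi> (2 * k + 1) - 1 = x} = {\<pi> \<in> ?T. \<pi> (2 * k + 1) = Suc x}"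
      using range by fastforce
    ultimately show "(\<Sum>\<pi>\<in>{\<pi> \<in> ?T. \<pi> (2 * k + 1) - 1 = x}. 1) = end_count k x"
      using card_odd_turning_perms_last[of x k] by simp
  qed
  finally show ?thesis .
qed

text \<open>Complementing all letters swaps peaks and valleys, which explains the symmetry. The
  proof uses the recursion instead: reflecting both \<open>x\<close> and \<open>y\<close> only
  changes the sign of \<open>x - 1 - y\<close>.\<close>

lemma end_count_symmetric: "x \<le> 2 * k \<Longrightarrow> end_count k (2 * k - x) = end_count k x"
proof (induction k arbitrary: x)
  case (Suc k)
  have "end_count (Suc k) (2 * Suc k - x) =
      (\<Sum>y\<le>2 * k. \<bar>real (2 * Suc k - x) - 1 - real (2 * k - y)\<bar> * end_count k (2 * k - y))"
    unfolding end_count.simps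
    by (rule sum.reindex_bij_witness[of _ "\<lambda>y. 2 * k - y" "\<lambda>y. 2 * k - y"]) auto
  also have "\<dots> = (\<Sum>y\<le>2 * k. \<bar>real x - 1 - real y\<bar> * end_count k y)"
  proof (rule sum.cong[OF refl])
    fix y assume y: "y \<in> {..2 * k}"
    have "real (2 * Suc k - x) - 1 - real (2 * k - y) = - (real x - 1 - real y)"
      using y Suc.prems by (simp add: of_nat_diff)
    then have "\<bar>real (2 * Suc k - x) - 1 - real (2 * k - y)\<bar> = \<bar>real x - 1 - real y\<bar>"
      by (simp only: abs_minus_cancel)
    moreover have "end_count k (2 * k - y) = end_count k y"
      using y Suc.IH by simp
    ultimately show "\<bar>real (2 * Suc k - x) - 1 - real (2 * k - y)\<bar> * end_count k (2 * k - y) =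
        \<bar>real x - 1 - real y\<bar> * end_count k y"
      by (simp only:)
  qed
  finally show ?case by simp
qed simp

text \<open>On the integers the second difference of the absolute value is 2 at the centre and 0
  elsewhere, so only \<open>y = x\<close> survives; the bound on \<open>x\<close> puts this term
  inside the sum.\<close>

lemma end_count_second_difference:
  assumes "x \<le> 2 * k"
  shows "end_count (Suc k) (Suc (Suc x)) - 2 * end_count (Suc k) (Suc x) + end_count (Suc k) x =
     2 * end_count k x"
proof -
  have "end_count (Suc k) (Suc (Suc x)) - 2 * end_count (Suc k) (Suc x) + end_count (Suc k) x =
      (\<Sum>y\<le>2 * k. (\<bar>real (Suc (Suc x)) - 1 - real y\<bar> - 2 * \<bar>real (Suc x) - 1 - real y\<bar> +
         \<bar>real x - 1 - real y\<bar>) * end_count k y)"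
    by (simp add: sum.distrib sum_subtractf sum_distrib_left algebra_simps del: of_nat_Suc)
  also have "\<dots> = (\<Sum>y\<le>2 * k. if y = x then 2 * end_count k y else 0)"
  proof (rule sum.cong[OF refl])
    fix y
    have "\<bar>real (Suc (Suc x)) - 1 - real y\<bar> - 2 * \<bar>real (Suc x) - 1 - real y\<bar> +
        \<bar>real x - 1 - real y\<bar> = (if y = x then 2 else 0)"
    proof (cases y x rule: linorder_cases)
      case less
      then have "real y + 1 \<le> real x" by linarith
      with less show ?thesis by simp
    next
      case greater
      then have "real x + 1 \<le> real y" by linarith
      with greater show ?thesis by simp
    qed simp
    then show "(\<bar>real (Suc (Suc x)) - 1 - real y\<bar> - 2 * \<bar>real (Suc x) - 1 - real y\<bar> +
        \<bar>real x - 1 - real y\<bar>) * end_count k y = (if y = x then 2 * end_count k y else 0)"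
      by simp
  qed
  also have "\<dots> = 2 * end_count k x"
    using assms by simp
  finally show ?thesis .
qed

section \<open>Value and slope at 0 of the last-letter counts\<close>

definition total_count :: "nat \<Rightarrow> real" where
  "total_count k = (\<Sum>x\<le>2 * k. end_count k x)"

text \<open>Average the sum with its reflection under \<open>y \<mapsto> 2 * k - y\<close>: the
  weights \<open>1 + y\<close> and \<open>1 + 2 * k - y\<close> add up to the constant
  \<open>2 * (k + 1)\<close>.\<close>

lemma end_count_Suc_0: "end_count (Suc k) 0 = (real k + 1) * total_count k"
proof -
  have "end_count (Suc k) 0 = (\<Sum>y\<le>2 * k. (1 + real y) * end_count k y)"
    unfolding end_count.simps by (rule sum.cong) (auto simp: abs_if)
  moreover have "\<dots> = (\<Sum>y\<le>2 * k. (1 + real (2 * k - y)) * end_count k (2 * k - y))"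
    by (rule sum.reindex_bij_witness[of _ "\<lambda>y. 2 * k - y" "\<lambda>y. 2 * k - y"]) auto
  moreover have "\<dots> = (\<Sum>y\<le>2 * k. (1 + (2 * real k - real y)) * end_count k y)"
    by (rule sum.cong) (auto simp: of_nat_diff end_count_symmetric)
  ultimately have "2 * end_count (Suc k) 0 =
      (\<Sum>y\<le>2 * k. (1 + real y) * end_count k y) +
      (\<Sum>y\<le>2 * k. (1 + (2 * real k - real y)) * end_count k y)"
    by simp
  also have "\<dots> = (\<Sum>y\<le>2 * k. 2 * (real k + 1) * end_count k y)"
    unfolding sum.distrib[symmetric] by (rule sum.cong) (auto simp: algebra_simps)
  also have "\<dots> = 2 * ((real k + 1) * total_count k)"
    by (simp only: total_count_def sum_distrib_left mult.assoc)
  finally show ?thesis by simp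
qed

text \<open>From \<open>x = 0\<close> to \<open>x = 1\<close> the kernel drops from
  \<open>y + 1\<close> to \<open>y\<close>, that is, by one for every \<open>y\<close>.\<close>

lemma end_count_Suc_1: "end_count (Suc k) (Suc 0) = end_count (Suc k) 0 - total_count k"
proof -
  have "end_count (Suc k) (Suc 0) - end_count (Suc k) 0 =
      (\<Sum>y\<le>2 * k. \<bar>real (Suc 0) - 1 - real y\<bar> * end_count k y - \<bar>real 0 - 1 - real y\<bar> * end_count k y)"
    unfolding end_count.simps sum_subtractf ..
  also have "\<dots> = (\<Sum>y\<le>2 * k. - end_count k y)"
    by (rule sum.cong) (auto simp: algebra_simps abs_if)
  finally show ?thesis
    by (simp add: total_count_def sum_negf)
qed

section \<open>Newton expansion and the recurrence for odd lengths\<close>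

text \<open>
  Newton's forward difference expansion of \<open>end_count k\<close> at \<open>0\<close>: its \<open>2 i\<close>-th and \<open>(2 i + 1)\<close>-st
  differences are \<open>2\<^sup>i\<close> times the value and the slope of \<open>end_count (k - i)\<close> at \<open>0\<close>.
\<close>

definition newton :: "nat \<Rightarrow> nat \<Rightarrow> real" where
  "newton k x = (\<Sum>i\<le>k. 2 ^ i * real (x choose (2 * i)) * end_count (k - i) 0) -
     (\<Sum>i<k. 2 ^ i * real (x choose (2 * i + 1)) * total_count (k - i - 1))"

text \<open>By Pascal's rule the second difference lowers the lower index of a binomial coefficient
  by 2 and kills the indices 0 and 1. Hence the terms \<open>i = 0\<close> vanish, and shifting
  \<open>i\<close> by one releases the factor 2.\<close>

lemma newton_second_difference:
  "newton (Suc k) (Suc (Suc x)) - 2 * newton (Suc k) (Suc x) + newton (Suc k) x = 2 * newton k x"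
proof -
  define d where "d j = real (Suc (Suc x) choose j) - 2 * real (Suc x choose j) + real (x choose j)" for j
  have d: "d 0 = 0" "d (Suc 0) = 0" "d (Suc (Suc j)) = real (x choose j)" for j
    by (simp_all add: d_def)
  have "newton (Suc k) (Suc (Suc x)) - 2 * newton (Suc k) (Suc x) + newton (Suc k) x =
      (\<Sum>i\<le>Suc k. 2 ^ i * d (2 * i) * end_count (Suc k - i) 0) -
      (\<Sum>i<Suc k. 2 ^ i * d (2 * i + 1) * total_count (Suc k - i - 1))"
    unfolding newton_def d_def
    by (simp add: sum.distrib sum_subtractf sum_distrib_left algebra_simps
             del: binomial_Suc_Suc sum.lessThan_Suc sum.atMost_Suc power_Suc)
  also have "(\<Sum>i\<le>Suc k. 2 ^ i * d (2 * i) * end_count (Suc k - i) 0) =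
      2 * (\<Sum>i\<le>k. 2 ^ i * real (x choose (2 * i)) * end_count (k - i) 0)"
    by (subst sum.atMost_Suc_shift) (simp add: d sum_distrib_left mult.assoc del: end_count.simps)
  also have "(\<Sum>i<Suc k. 2 ^ i * d (2 * i + 1) * total_count (Suc k - i - 1)) =
      2 * (\<Sum>i<k. 2 ^ i * real (x choose (2 * i + 1)) * total_count (k - i - 1))"
    by (subst sum.lessThan_Suc_shift) (simp add: d sum_distrib_left mult.assoc)
  finally show ?thesis
    by (simp add: newton_def right_diff_distrib)
qed

lemma newton_0: "newton k 0 = end_count k 0"
  by (subst newton_def, subst sum.atMost_shift) simp

lemma newton_Suc_1: "newton (Suc k) (Suc 0) = end_count (Suc k) 0 - total_count k"
  unfolding newton_def
  by (subst sum.atMost_Suc_shift, subst sum.lessThan_Suc_shift)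
     (simp del: end_count.simps)

text \<open>Both sides agree at 0 and 1 and, by the induction hypothesis for \<open>k\<close>, have
  the same second difference, which determines them up to \<open>2 * Suc k\<close>.\<close>

lemma end_count_eq_newton: "x \<le> 2 * k \<Longrightarrow> end_count k x = newton k x"
proof (induction k arbitrary: x)
  case 0
  then show ?case by (simp add: newton_def)
next
  case (Suc k)
  from Suc.prems show ?case
  proof (induction x rule: induct_nat_012)
    case 0
    show ?case by (simp only: newton_0)
  next
    case 1
    show ?case by (simp only: newton_Suc_1 end_count_Suc_1)
  next
    case (ge2 x)
    then have "x \<le> 2 * k" "end_count (Suc k) x = newton (Suc k) x"
      "end_count (Suc k) (Suc x) = newton (Suc k) (Suc x)"
      by (auto simp del: end_count.simps)
    then show ?case
      using end_count_second_difference[of x k] newton_second_difference[of k x] Suc.IH[of x]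
      by linarith
  qed
qed

text \<open>Summing the Newton expansion over \<open>x\<close> uses the hockey-stick identity, which
  raises both binomial indices.\<close>

lemma total_count_eq:
  "total_count k =
     (\<Sum>i\<le>k. 2 ^ i * real (2 * k + 1 choose (2 * i + 1)) * end_count (k - i) 0) -
     (\<Sum>i<k. 2 ^ i * real (2 * k + 1 choose (2 * i + 2)) * total_count (k - i - 1))"
proof -
  have choose: "(\<Sum>x\<le>2 * k. real (x choose m)) = real (2 * k + 1 choose (m + 1))" for m
    using sum_choose_upper[of m "2 * k"] by (simp flip: of_nat_sum)
  have "total_count k = (\<Sum>x\<le>2 * k. newton k x)"
    unfolding total_count_def by (rule sum.cong) (auto simp: end_count_eq_newton)
  also have "\<dots> =
      (\<Sum>i\<le>k. \<Sum>x\<le>2 * k. 2 ^ i * real (x choose (2 * i)) * end_count (k - i) 0) -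
      (\<Sum>i<k. \<Sum>x\<le>2 * k. 2 ^ i * real (x choose (2 * i + 1)) * total_count (k - i - 1))"
    unfolding newton_def sum_subtractf
    by (subst sum.swap, subst (2) sum.swap) simp
  finally show ?thesis
    by (simp only: sum_distrib_left[symmetric] sum_distrib_right[symmetric] choose) simp
qed

section \<open>Generating functions\<close>

lemma fps_nth_compose_X_squared:
  "fps_nth (f oo fps_X\<^sup>2) n = (if even n then fps_nth f (n div 2) else (0 :: 'a :: comm_ring_1))"
proof -
  have "fps_nth (f oo fps_X\<^sup>2) n = (\<Sum>i=0..n. if n = 2 * i then fps_nth f i else 0)"
    unfolding fps_compose_nth
    by (rule sum.cong) (auto simp: fps_X_power_nth simp flip: power_mult)
  also have "\<dots> = (\<Sum>i\<in>{0..n}. if i = n div 2 then if even n then fps_nth f i else 0 else 0)"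
    by (rule sum.cong) auto
  also have "\<dots> = (if even n then fps_nth f (n div 2) else 0)"
    by simp
  finally show ?thesis .
qed

text \<open>
  The next three series are in the variable \<open>x\<^sup>2\<close>: composing with \<open>fps_X\<^sup>2\<close> and multiplying by
  \<open>fps_X\<close>, \<open>fps_X\<close> and \<open>fps_X\<^sup>2\<close> gives \<open>F\<close>, \<open>sinh (sqrt 2 x) / sqrt 2\<close> and
  \<open>(cosh (sqrt 2 x) - 1) / 2\<close>.
\<close>

definition total_fps :: "real fps" where
  "total_fps = Abs_fps (\<lambda>k. total_count k / fact (2 * k + 1))"

definition sinh_coeffs :: "real fps" where
  "sinh_coeffs = Abs_fps (\<lambda>i. 2 ^ i / fact (2 * i + 1))"

definition cosh_coeffs :: "real fps" where
  "cosh_coeffs = Abs_fps (\<lambda>i. 2 ^ i / fact (2 * i + 2))"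

text \<open>Dividing the recurrence for \<open>total_count\<close> by
  \<open>fact (2 * k + 1)\<close> turns its binomial sums into Cauchy products.\<close>

lemma total_fps_eq:
  "total_fps = sinh_coeffs * (1 + fps_const (1 / 2) * (fps_X * total_fps)) -
     fps_X * (cosh_coeffs * total_fps)"
proof (rule fps_ext)
  fix k
  \<comment> \<open>The value at 0 is \<open>(l + 1) * total_count l\<close> for
    \<open>k = Suc l\<close>, and \<open>fact (2 * l + 2)\<close> is
    \<open>2 * (l + 1) * fact (2 * l + 1)\<close>; the quotient leaves the factor 1/2.\<close>
  have P: "1 + fps_const (1 / 2) * (fps_X * total_fps) = Abs_fps (\<lambda>k. end_count k 0 / fact (2 * k))"
  proof (rule fps_ext)
    fix k
    show "fps_nth (1 + fps_const (1 / 2) * (fps_X * total_fps)) k =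
        fps_nth (Abs_fps (\<lambda>k. end_count k 0 / fact (2 * k))) k"
    proof (cases k)
      case (Suc l)
      have "(fact (2 * Suc l) :: real) = 2 * (real l + 1) * fact (2 * l + 1)"
        using fact_Suc[of "2 * l + 1", where ?'a = real] by (simp del: fact_Suc)
      moreover have "2 * (real l + 1) \<noteq> 0" "(fact (2 * l + 1) :: real) \<noteq> 0"
        by simp_all
      ultimately show ?thesis
        by (simp add: Suc total_fps_def end_count_Suc_0 divide_simps
                 del: end_count.simps(2) fact_Suc mult_Suc_right)
    qed simp
  qed
  have "fps_nth (sinh_coeffs * Abs_fps (\<lambda>k. end_count k 0 / fact (2 * k))) k =
      (\<Sum>i\<le>k. 2 ^ i * real (2 * k + 1 choose (2 * i + 1)) * end_count (k - i) 0) / fact (2 * k + 1)"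
    unfolding fps_mult_nth sum_divide_distrib atLeast0AtMost
  proof (rule sum.cong[OF refl])
    fix i assume "i \<in> {..k}"
    then have "real (2 * k + 1 choose (2 * i + 1)) =
        fact (2 * k + 1) / (fact (2 * i + 1) * fact (2 * (k - i)))"
      by (subst binomial_fact) (auto simp: diff_mult_distrib2)
    then show "fps_nth sinh_coeffs i * fps_nth (Abs_fps (\<lambda>k. end_count k 0 / fact (2 * k))) (k - i) =
        2 ^ i * real (2 * k + 1 choose (2 * i + 1)) * end_count (k - i) 0 / fact (2 * k + 1)"
      by (simp add: sinh_coeffs_def del: fact_Suc binomial_Suc_Suc)
  qed
  moreover have "fps_nth (fps_X * (cosh_coeffs * total_fps)) k =
      (\<Sum>i<k. 2 ^ i * real (2 * k + 1 choose (2 * i + 2)) * total_count (k - i - 1)) / fact (2 * k + 1)"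
  proof (cases k)
    case (Suc l)
    have "fps_nth (cosh_coeffs * total_fps) l =
        (\<Sum>i\<le>l. 2 ^ i * real (2 * k + 1 choose (2 * i + 2)) * total_count (k - i - 1) / fact (2 * k + 1))"
      unfolding fps_mult_nth atLeast0AtMost
    proof (rule sum.cong[OF refl])
      fix i assume i: "i \<in> {..l}"
      have "2 * k + 1 - (2 * i + 2) = 2 * (l - i) + 1"
        using i Suc by auto
      then have "real (2 * k + 1 choose (2 * i + 2)) =
          fact (2 * k + 1) / (fact (2 * i + 2) * fact (2 * (l - i) + 1))"
        using i Suc by (subst binomial_fact) auto
      moreover have "k - i - 1 = l - i"
        using Suc by simp
      ultimately show "fps_nth cosh_coeffs i * fps_nth total_fps (l - i) =
          2 ^ i * real (2 * k + 1 choose (2 * i + 2)) * total_count (k - i - 1) / fact (2 * k + 1)"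
        by (simp add: cosh_coeffs_def total_fps_def del: fact_Suc binomial_Suc_Suc)
    qed
    then show ?thesis
      by (simp add: Suc sum_divide_distrib lessThan_Suc_atMost del: fact_Suc binomial_Suc_Suc)
  qed simp
  ultimately show "fps_nth total_fps k =
      fps_nth (sinh_coeffs * (1 + fps_const (1 / 2) * (fps_X * total_fps)) -
        fps_X * (cosh_coeffs * total_fps)) k"
    unfolding P
    by (simp add: total_fps_def total_count_eq[of k] diff_divide_distrib
             del: fact_Suc binomial_Suc_Suc)
qed

section \<open>Hyperbolic functions and the solved linear equation\<close>

lemma fps_sinh_sqrt_two:
  "fps_sinh (sqrt 2) = fps_const (sqrt 2) * (fps_X * (sinh_coeffs oo fps_X\<^sup>2))"
proof (rule fps_ext)
  fix n
  show "fps_nth (fps_sinh (sqrt 2)) n =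
      fps_nth (fps_const (sqrt 2) * (fps_X * (sinh_coeffs oo fps_X\<^sup>2))) n"
  proof (cases "even n")
    case True
    then show ?thesis
      by (auto simp: fps_sinh_def fps_nth_compose_X_squared)
  next
    case False
    then obtain i where "n = 2 * i + 1" by (elim oddE)
    then show ?thesis
      by (simp add: fps_sinh_def fps_nth_compose_X_squared sinh_coeffs_def power_mult power_mult_distrib
               del: fact_Suc)
  qed
qed

lemma fps_cosh_sqrt_two:
  "fps_cosh (sqrt 2) = 1 + 2 * (fps_X\<^sup>2 * (cosh_coeffs oo fps_X\<^sup>2))"
proof (rule fps_ext)
  fix n
  show "fps_nth (fps_cosh (sqrt 2)) n =
      fps_nth (1 + 2 * (fps_X\<^sup>2 * (cosh_coeffs oo fps_X\<^sup>2))) n"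
  proof (cases "even n")
    case True
    then obtain m where m: "n = 2 * m" by (elim evenE)
    show ?thesis
    proof (cases m)
      case 0
      with m show ?thesis
        by (simp add: fps_cosh_def)
    next
      case (Suc i)
      have "sqrt 2 ^ n = 2 ^ Suc i" "(- sqrt 2) ^ n = 2 ^ Suc i"
        unfolding m Suc power_mult by simp_all
      then have "fps_nth (fps_cosh (sqrt 2)) n = 2 * 2 ^ i / fact n"
        by (simp add: fps_cosh_def)
      also have "\<dots> = fps_nth (1 + 2 * (fps_X\<^sup>2 * (cosh_coeffs oo fps_X\<^sup>2))) n"
        by (simp add: m Suc fps_nth_compose_X_squared cosh_coeffs_def fps_X_power_mult_nth
              numeral_fps_const del: fact_Suc)
      finally show ?thesis .
    qed
  next
    case False
    then show ?thesis
      by (auto simp: fps_cosh_def fps_nth_compose_X_squared fps_X_power_mult_nth numeral_fps_const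
               dest: odd_pos)
  qed
qed

definition odd_egf :: "real fps" where
  "odd_egf = fps_X * (total_fps oo fps_X\<^sup>2)"

text \<open>With \<open>S\<close>, \<open>H\<close>, \<open>U\<close> for the three series in
  \<open>fps_X\<^sup>2\<close>, the functional equation reads
  \<open>U * (2 + 2 * fps_X\<^sup>2 * H - fps_X\<^sup>2 * S) = 2 * S\<close>, and the bracket is
  half the denominator of the theorem.\<close>

lemma odd_egf_eq:
  "(2 + 2 * fps_cosh (sqrt 2) - fps_const (sqrt 2) * fps_X * fps_sinh (sqrt 2)) * odd_egf =
     2 * fps_const (sqrt 2) * fps_sinh (sqrt 2)"
proof -
  have X: "fps_nth (fps_X\<^sup>2 :: real fps) 0 = 0"
    by (simp add: power2_eq_square)
  define S where "S = sinh_coeffs oo fps_X\<^sup>2"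
  define H where "H = cosh_coeffs oo fps_X\<^sup>2"
  define U where "U = total_fps oo fps_X\<^sup>2"
  have half: "2 * fps_const (1 / 2) = (1 :: real fps)"
    by (simp add: numeral_fps_const)
  have sq: "fps_const (sqrt 2) * fps_const (sqrt 2) = (2 :: real fps)"
    by (simp add: numeral_fps_const)
  have U: "U = S * (1 + fps_const (1 / 2) * (fps_X\<^sup>2 * U)) - fps_X\<^sup>2 * (H * U)"
    unfolding U_def S_def H_def
    by (subst total_fps_eq)
       (simp add: fps_compose_sub_distrib fps_compose_add_distrib fps_compose_mult_distrib[OF X]
          fps_X_fps_compose_startby0[OF X])
  have "2 * U = 2 * (S * (1 + fps_const (1 / 2) * (fps_X\<^sup>2 * U)) - fps_X\<^sup>2 * (H * U))"
    using U by (rule arg_cong)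
  also have "\<dots> = 2 * S + (2 * fps_const (1 / 2)) * (S * fps_X\<^sup>2 * U) - 2 * (fps_X\<^sup>2 * (H * U))"
    by (simp add: algebra_simps)
  finally have U2: "2 * U = 2 * S + S * fps_X\<^sup>2 * U - 2 * (fps_X\<^sup>2 * (H * U))"
    by (simp add: half)
  have "(2 + 2 * fps_cosh (sqrt 2) - fps_const (sqrt 2) * fps_X * fps_sinh (sqrt 2)) * odd_egf =
      (4 + 4 * (fps_X\<^sup>2 * H) - (fps_const (sqrt 2) * fps_const (sqrt 2)) * fps_X\<^sup>2 * S) * (fps_X * U)"
    by (simp add: odd_egf_def fps_cosh_sqrt_two fps_sinh_sqrt_two S_def H_def U_def
          algebra_simps power2_eq_square)
  also have "\<dots> = 2 * (2 * U + 2 * (fps_X\<^sup>2 * (H * U)) - S * fps_X\<^sup>2 * U) * fps_X"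
    unfolding sq by (simp add: algebra_simps)
  also have "\<dots> = 2 * 2 * S * fps_X"
    by (simp add: U2)
  also have "\<dots> = 2 * (fps_const (sqrt 2) * fps_const (sqrt 2)) * S * fps_X"
    unfolding sq ..
  also have "\<dots> = 2 * fps_const (sqrt 2) * fps_sinh (sqrt 2)"
    by (simp only: fps_sinh_sqrt_two S_def mult.assoc mult.commute mult.left_commute)
  finally show ?thesis .
qed

section \<open>The two counting series in terms of the odd-length series\<close>

lemma num_odd_peaks_valleys_eq: "num_odd_peaks_valleys n = card (turning_perms odd n)"
  by (simp add: num_odd_peaks_valleys_def turning_perms_def)

lemma num_even_peaks_valleys_eq: "num_even_peaks_valleys n = card (turning_perms even n)"
  by (simp add: num_even_peaks_valleys_def turning_perms_def)

lemma card_turning_perms_0: "card (turning_perms P 0) = 1"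
proof -
  have "turning_perms P 0 = {id}"
    by (auto simp: turning_perms_def is_peak_def is_valley_def)
  then show ?thesis by simp
qed

text \<open>A free last letter contributes exactly the new factor of the factorial, so the
  exponential coefficient is copied to the next length.\<close>

lemma turning_perms_egf_coeff_Suc:
  assumes "P n \<or> n < 2"
  shows "real (card (turning_perms P (Suc n))) / fact (Suc n) = real (card (turning_perms P n)) / fact n"
  unfolding card_turning_perms_Suc[of P n, OF assms] of_nat_mult fact_Suc
  by (rule mult_divide_mult_cancel_left) simp

lemma odd_egf_nth:
  "fps_nth odd_egf n = (if odd n then real (num_odd_peaks_valleys n) / fact n else 0)"
proof (cases "even n")
  case True
  then show ?thesis
    by (auto simp: odd_egf_def fps_nth_compose_X_squared)
next
  case False
  then obtain k where "n = 2 * k + 1" by (elim oddE)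
  then show ?thesis
    using card_odd_turning_perms_odd[of k]
    by (simp add: odd_egf_def fps_nth_compose_X_squared total_fps_def total_count_def
          num_odd_peaks_valleys_eq del: fact_Suc)
qed

text \<open>A positive even length is \<open>Suc m\<close> with \<open>m\<close> odd, where turning
  is allowed, so the coefficient is that of length \<open>m\<close>. The summand 1 is the empty
  permutation.\<close>

lemma num_odd_peaks_valleys_even_nth:
  assumes "even n"
  shows "real (num_odd_peaks_valleys n) / fact n = fps_nth (1 + fps_X * odd_egf) n"
proof (cases n)
  case 0
  then show ?thesis
    by (simp add: num_odd_peaks_valleys_eq card_turning_perms_0)
next
  case (Suc m)
  then have "odd m" using assms by simp
  then show ?thesis
    using turning_perms_egf_coeff_Suc[of odd m]
    by (simp add: Suc num_odd_peaks_valleys_eq odd_egf_nth del: fact_Suc)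
qed

lemma num_odd_egf:
  "Abs_fps (\<lambda>n. real (num_odd_peaks_valleys n) / fact n) = 1 + odd_egf + fps_X * odd_egf"
proof (rule fps_ext)
  fix n
  show "fps_nth (Abs_fps (\<lambda>n. real (num_odd_peaks_valleys n) / fact n)) n =
      fps_nth (1 + odd_egf + fps_X * odd_egf) n"
    using num_odd_peaks_valleys_even_nth[of n]
    by (cases "even n") (auto simp: odd_egf_nth dest: odd_pos)
qed

text \<open>In even length, reversal reduces to the odd case. In odd length the last position but
  one is even and hence unconstrained, so coefficients are copied from the preceding even length;
  this is the factor \<open>1 + fps_X\<close>.\<close>

lemma num_even_egf:
  "Abs_fps (\<lambda>n. real (num_even_peaks_valleys n) / fact n) = (1 + fps_X) * (1 + fps_X * odd_egf)"
proof (rule fps_ext)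
  fix n
  have even: "real (num_even_peaks_valleys m) / fact m = fps_nth (1 + fps_X * odd_egf) m" if "even m" for m
  proof -
    have "card (turning_perms even m) = card (turning_perms odd m)"
      by (rule card_turning_perms_reverse) (use that in auto)
    then show ?thesis
      using num_odd_peaks_valleys_even_nth[OF that]
      by (simp add: num_odd_peaks_valleys_eq num_even_peaks_valleys_eq)
  qed
  \<comment> \<open>Since \<open>1 + fps_X * odd_egf\<close> has only even terms, its two copies in
    the product never overlap.\<close>
  have odd: "fps_nth (1 + fps_X * odd_egf) m = 0" if "odd m" for m
    using that by (cases m) (auto simp: odd_egf_nth)
  show "fps_nth (Abs_fps (\<lambda>n. real (num_even_peaks_valleys n) / fact n)) n =
      fps_nth ((1 + fps_X) * (1 + fps_X * odd_egf)) n"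
  proof (cases "even n")
    case True
    then have "n \<noteq> 0 \<Longrightarrow> odd (n - 1)" by simp
    with True even[of n] odd[of "n - 1"] show ?thesis
      unfolding fps_mult_fps_X_plus_1_nth by simp
  next
    case False
    then obtain m where m: "n = Suc m" by (cases n) auto
    with False have "even m" by simp
    then have "real (num_even_peaks_valleys n) / fact n = real (num_even_peaks_valleys m) / fact m"
      using turning_perms_egf_coeff_Suc[of even m]
      by (simp add: m num_even_peaks_valleys_eq del: fact_Suc)
    with False m even[OF \<open>even m\<close>] odd[of n] show ?thesis
      unfolding fps_mult_fps_X_plus_1_nth by simp
  qed
qed

theorem theorem4:
  shows "Abs_fps (\<lambda>n. real (num_even_peaks_valleys n) / fact n) =
           (1 + fps_X) *
           ((2 + 2 * fps_cosh (sqrt 2) + fps_const (sqrt 2) * fps_X * fps_sinh (sqrt 2)) /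
            (2 + 2 * fps_cosh (sqrt 2) - fps_const (sqrt 2) * fps_X * fps_sinh (sqrt 2))) \<and>
         Abs_fps (\<lambda>n. real (num_odd_peaks_valleys n) / fact n) =
           (2 + 2 * fps_cosh (sqrt 2) + fps_const (sqrt 2) * (2 + fps_X) * fps_sinh (sqrt 2)) /
           (2 + 2 * fps_cosh (sqrt 2) - fps_const (sqrt 2) * fps_X * fps_sinh (sqrt 2))"
proof -
  let ?s = "fps_const (sqrt 2) * fps_sinh (sqrt 2)"
  let ?D = "2 + 2 * fps_cosh (sqrt 2) - fps_const (sqrt 2) * fps_X * fps_sinh (sqrt 2)"
  \<comment> \<open>A nonzero constant term makes the denominator nonzero, as cancellation in the
    quotients requires.\<close>
  have "fps_nth ?D 0 = 4"
    by (simp add: fps_cosh_def)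
  then have D: "?D \<noteq> 0" by fastforce
  have C: "?D * odd_egf = 2 * ?s"
    using odd_egf_eq by (simp add: mult.assoc)
  have "?D * (1 + fps_X * odd_egf) = ?D + fps_X * (?D * odd_egf)"
    by (simp add: algebra_simps)
  \<comment> \<open>Adding \<open>2 * fps_X * ?s\<close> flips the sign of the last term of the
    denominator, which yields the numerator.\<close>
  also have "\<dots> = 2 + 2 * fps_cosh (sqrt 2) + fps_const (sqrt 2) * fps_X * fps_sinh (sqrt 2)"
    unfolding C by (simp add: algebra_simps)
  finally have even: "1 + fps_X * odd_egf =
      (2 + 2 * fps_cosh (sqrt 2) + fps_const (sqrt 2) * fps_X * fps_sinh (sqrt 2)) / ?D"
    using D by (metis nonzero_mult_div_cancel_left)
  have "?D * (1 + odd_egf + fps_X * odd_egf) = ?D + ?D * odd_egf + fps_X * (?D * odd_egf)"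
    by (simp add: algebra_simps)
  also have "\<dots> = 2 + 2 * fps_cosh (sqrt 2) + fps_const (sqrt 2) * (2 + fps_X) * fps_sinh (sqrt 2)"
    unfolding C by (simp add: algebra_simps)
  finally have odd: "1 + odd_egf + fps_X * odd_egf =
      (2 + 2 * fps_cosh (sqrt 2) + fps_const (sqrt 2) * (2 + fps_X) * fps_sinh (sqrt 2)) / ?D"
    using D by (metis nonzero_mult_div_cancel_left)
  show ?thesis
    unfolding num_even_egf num_odd_egf even[symmetric] odd[symmetric] by simp
qed

end
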